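(* Let $\Phi=(v_j)_{j=1}^n$ and $\Psi=(w_j)_{j=1}^n$ be two sequences of $n$ vectors in inner product spaces (both real or both complex). Then $\Phi$ and $\Psi$ are projectively unitarily equivalent if and only if their $m$-products are equal, i.e. $$\Delta(v_{j_1},v_{j_2},\ldots,v_{j_m})=\Delta(w_{j_1},w_{j_2},\ldots,w_{j_m})\qquad\text{for all } 1\le m\le n \text{ and all } 1\le j_1,\ldots,j_m\le n.$$
   Context: Inner products are linear in the first variable. Let $(v_j)$ and $(w_j)$ be finite sequences with the same index set, in inner product spaces over the same field ($\mathbb{R}$ or $\mathbb{C}$), and let $\mathcal{H}_1=\mathrm{span}\{v_j\}$, $\mathcal{H}_2=\mathrm{span}\{w_j\}$. They are projectively unitarily equivalent if there are a unitary map (surjective linear isometry) $U:\mathcal{H}_1\to\mathcal{H}_2$ and scalars $c_j$ with $|c_j|=1$ such that $w_j=c_jUv_j$ for all $j$. The $m$-products (Bargmann invariants) of a sequence $(v_j)$ are $$\Delta(v_{j_1},v_{j_2},\ldots,v_{j_m}):=\langle v_{j_1},v_{j_2}\rangle\langle v_{j_2},v_{j_3}\rangle\cdots\langle v_{j_{m-1}},v_{j_m}\rangle\langle v_{j_m},v_{j_1}\rangle,$$ where the indices need not be distinct; in particular $\Delta(v_j)=\langle v_j,v_j\rangle$ and $\Delta(v_j,v_k)=|\langle v_j,v_k\rangle|^2$. *)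

theory Defs
  imports "HOL-Analysis.Analysis"
begin

text \<open>
  Real inner product spaces are the library's class \<open>real_inner\<close>. There is no complex
  counterpart in the distribution, so it is introduced here. As over the reals, no
  completeness and no finite dimension is required.
\<close>

class complex_inner = ab_group_add +
  fixes scaleC :: "complex \<Rightarrow> 'a \<Rightarrow> 'a"  (infixr "*\<^sub>C" 75)
    and cinner :: "'a \<Rightarrow> 'a \<Rightarrow> complex"
  assumes scaleC_add_right: "a *\<^sub>C (x + y) = a *\<^sub>C x + a *\<^sub>C y"
    and scaleC_add_left: "(a + b) *\<^sub>C x = a *\<^sub>C x + b *\<^sub>C x"
    and scaleC_scaleC: "a *\<^sub>C b *\<^sub>C x = (a * b) *\<^sub>C x"
    and scaleC_one: "1 *\<^sub>C x = x"
    and cinner_commute: "cinner x y = cnj (cinner y x)"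
    and cinner_add_left: "cinner (x + y) z = cinner x z + cinner y z"
    and cinner_scaleC_left: "cinner (a *\<^sub>C x) y = a * cinner x y"
    and cinner_ge_zero: "0 \<le> Re (cinner x x)"
    and cinner_eq_zero_iff: "cinner x x = 0 \<longleftrightarrow> x = 0"

lemma vector_space_scaleC:
  "vector_space (scaleC :: complex \<Rightarrow> 'a::complex_inner \<Rightarrow> 'a)"
  by unfold_locales
    (simp_all add: scaleC_add_right scaleC_add_left scaleC_scaleC scaleC_one)

instantiation complex :: complex_inner
begin

definition scaleC_complex :: "complex \<Rightarrow> complex \<Rightarrow> complex"
  where "scaleC_complex a x = a * x"

definition cinner_complex :: "complex \<Rightarrow> complex \<Rightarrow> complex"
  where "cinner_complex x y = x * cnj y"

instance
  by standard (auto simp: scaleC_complex_def cinner_complex_def algebra_simps)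

end

instantiation vec :: (complex_inner, finite) complex_inner
begin

definition scaleC_vec :: "complex \<Rightarrow> 'a ^ 'b \<Rightarrow> 'a ^ 'b"
  where "scaleC_vec a x = (\<chi> i. a *\<^sub>C (x $ i))"

definition cinner_vec :: "'a ^ 'b \<Rightarrow> 'a ^ 'b \<Rightarrow> complex"
  where "cinner_vec x y = (\<Sum>i\<in>UNIV. cinner (x $ i) (y $ i))"

instance
proof
  fix a b :: complex and x y z :: "'a ^ 'b"
  show "a *\<^sub>C (x + y) = a *\<^sub>C x + a *\<^sub>C y" "(a + b) *\<^sub>C x = a *\<^sub>C x + b *\<^sub>C x"
    "a *\<^sub>C b *\<^sub>C x = (a * b) *\<^sub>C x" "1 *\<^sub>C x = x"
    by (simp_all add: vec_eq_iff scaleC_vec_def scaleC_add_right scaleC_add_left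
        scaleC_scaleC scaleC_one)
  show "cinner x y = cnj (cinner y x)"
    unfolding cinner_vec_def cnj_sum by (intro sum.cong refl cinner_commute)
  show "cinner (x + y) z = cinner x z + cinner y z"
    by (simp add: cinner_vec_def cinner_add_left sum.distrib)
  show "cinner (a *\<^sub>C x) y = a * cinner x y"
    by (simp add: cinner_vec_def scaleC_vec_def cinner_scaleC_left sum_distrib_left)
  show "0 \<le> Re (cinner x x)"
    by (simp add: cinner_vec_def cinner_ge_zero sum_nonneg)
  show "cinner x x = 0 \<longleftrightarrow> x = 0"
  proof
    assume "cinner x x = 0"
    then have "(\<Sum>i\<in>UNIV. Re (cinner (x $ i) (x $ i))) = 0"
      by (metis Re_sum cinner_vec_def zero_complex.sel(1))
    then have re: "Re (cinner (x $ i) (x $ i)) = 0" for i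
      by (simp add: sum_nonneg_eq_0_iff cinner_ge_zero)
    have im: "Im (cinner (x $ i) (x $ i)) = 0" for i
      using arg_cong[OF cinner_commute[of "x $ i" "x $ i"], of Im] by simp
    have "cinner (x $ i) (x $ i) = 0" for i
      using re im by (simp add: complex_eq_iff)
    then show "x = 0"
      by (simp add: vec_eq_iff cinner_eq_zero_iff)
  next
    assume "x = 0"
    then show "cinner x x = 0"
      by (simp add: cinner_vec_def cinner_eq_zero_iff)
  qed
qed

end

text \<open>
  The remaining definitions serve both fields: they take the scalar multiplication and the
  inner product as arguments, to be instantiated by \<open>scaleR\<close> and \<open>inner\<close>, or by \<open>scaleC\<close>
  and \<open>cinner\<close>.
\<close>

text \<open>
  The indices wrap around, so the last factor pairs the last vector with the first; for a
  one-element list the only factor is the inner product of the vector with itself.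
\<close>

definition m_product :: "('a \<Rightarrow> 'a \<Rightarrow> 'k::comm_monoid_mult) \<Rightarrow> 'a list \<Rightarrow> 'k"
  where "m_product ip xs = (\<Prod>i<length xs. ip (xs ! i) (xs ! (Suc i mod length xs)))"

text \<open>
  The inner product of a vector with itself is a nonnegative element of the scalar field;
  the absolute value only turns it into a number of type \<open>real\<close>.
\<close>

definition induced_norm :: "('a \<Rightarrow> 'a \<Rightarrow> 'k::real_normed_field) \<Rightarrow> 'a \<Rightarrow> real"
  where "induced_norm ip x = sqrt (norm (ip x x))"

text \<open>
  \<open>U\<close> is a total function of the logic, but only its values on \<open>H\<^sub>1\<close> matter.
\<close>

definition unitary_map ::
  "('k::real_normed_field \<Rightarrow> 'a::ab_group_add \<Rightarrow> 'a) \<Rightarrow> ('a \<Rightarrow> 'a \<Rightarrow> 'k) \<Rightarrow> 'a set \<Rightarrow>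
   ('k \<Rightarrow> 'b::ab_group_add \<Rightarrow> 'b) \<Rightarrow> ('b \<Rightarrow> 'b \<Rightarrow> 'k) \<Rightarrow> 'b set \<Rightarrow> ('a \<Rightarrow> 'b) \<Rightarrow> bool"
  where "unitary_map scale\<^sub>1 ip\<^sub>1 H\<^sub>1 scale\<^sub>2 ip\<^sub>2 H\<^sub>2 U \<longleftrightarrow>
    (\<forall>x\<in>H\<^sub>1. \<forall>y\<in>H\<^sub>1. U (x + y) = U x + U y) \<and>
    (\<forall>a. \<forall>x\<in>H\<^sub>1. U (scale\<^sub>1 a x) = scale\<^sub>2 a (U x)) \<and>
    (\<forall>x\<in>H\<^sub>1. induced_norm ip\<^sub>2 (U x) = induced_norm ip\<^sub>1 x) \<and>
    U ` H\<^sub>1 = H\<^sub>2"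

definition projectively_unitarily_equivalent ::
  "('k::real_normed_field \<Rightarrow> 'a::ab_group_add \<Rightarrow> 'a) \<Rightarrow> ('a \<Rightarrow> 'a \<Rightarrow> 'k) \<Rightarrow>
   ('k \<Rightarrow> 'b::ab_group_add \<Rightarrow> 'b) \<Rightarrow> ('b \<Rightarrow> 'b \<Rightarrow> 'k) \<Rightarrow>
   'i set \<Rightarrow> ('i \<Rightarrow> 'a) \<Rightarrow> ('i \<Rightarrow> 'b) \<Rightarrow> bool"
  where "projectively_unitarily_equivalent scale\<^sub>1 ip\<^sub>1 scale\<^sub>2 ip\<^sub>2 J v w \<longleftrightarrow>
    (\<exists>U c. unitary_map scale\<^sub>1 ip\<^sub>1 (module.span scale\<^sub>1 (v ` J))
                       scale\<^sub>2 ip\<^sub>2 (module.span scale\<^sub>2 (w ` J)) U \<and>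
           (\<forall>j\<in>J. norm (c j) = 1 \<and> w j = scale\<^sub>2 (c j) (U (v j))))"

end

theory Submission
  imports Defs
begin

text \<open>
  Inner products of spanning vectors determine the span up to a unitary map, so projective
  unitary equivalence of \<open>v\<close> and \<open>w\<close> means that the Gramians are related by
  \<open>\<langle>w j, w k\<rangle> = c j * conj (c k) * \<langle>v j, v k\<rangle>\<close> with unimodular \<open>c\<close>. Such factors
  cancel around closed walks, hence in the \<open>m\<close>-products. Conversely, a closed walk that
  revisits a vertex splits there into two shorter ones, so equality of the \<open>m\<close>-products with
  \<open>m \<le> n\<close> gives equality for all \<open>m\<close>. In the graph with an edge wherever
  \<open>\<langle>v j, v k\<rangle> \<noteq> 0\<close>, the conjugate of \<open>c j\<close> is then taken as the quotient of the Gramian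
  products along a walk from a root of the component to \<open>j\<close>; closed walks through the root
  give the relation on each edge.
\<close>

section \<open>Products along walks\<close>

fun walk_product :: "('i \<Rightarrow> 'i \<Rightarrow> 'k::comm_monoid_mult) \<Rightarrow> 'i list \<Rightarrow> 'k" where
  "walk_product f (x # y # zs) = f x y * walk_product f (y # zs)"
| "walk_product f _ = 1"

text \<open>The cut vertex \<open>y\<close> ends one factor and starts the other, so no edge is lost
  or counted twice.\<close>

lemma walk_product_append:
  "walk_product f (xs @ y # ys) = walk_product f (xs @ [y]) * walk_product f (y # ys)"
  by (induction f xs rule: walk_product.induct) (auto simp: mult.assoc neq_Nil_conv)

lemma walk_product_append2:
  "xs \<noteq> [] \<Longrightarrow> walk_product f (xs @ y # ys) = walk_product f xs * f (last xs) y * walk_product f (y # ys)"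
  by (induction f xs rule: walk_product.induct) (auto simp: mult.assoc)

lemma walk_product_conv_prod:
  "walk_product f xs = (\<Prod>i<length xs - 1. f (xs ! i) (xs ! Suc i))"
  by (induction f xs rule: walk_product.induct) (simp_all add: prod.lessThan_Suc_shift del: prod.lessThan_Suc)

text \<open>Repeating the first vertex at the end turns the cyclic wrap-around into an ordinary
  edge, so cutting rules for walks apply to m-products.\<close>

lemma m_product_Cons: "m_product f (x # xs) = walk_product f (x # xs @ [x])"
proof -
  have "(x # xs) ! (Suc i mod length (x # xs)) = (x # xs @ [x]) ! Suc i"
    and "(x # xs) ! i = (x # xs @ [x]) ! i" if "i < length (x # xs)" for i
    using that by (cases "Suc i = length (x # xs)"; auto simp: nth_append nth_Cons split: nat.splits)+
  then show ?thesis
    unfolding m_product_def walk_product_conv_prod by (intro prod.cong) auto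
qed

lemma m_product_map: "m_product f (map v js) = m_product (\<lambda>i j. f (v i) (v j)) js"
proof -
  have "map v js ! (Suc i mod length js) = v (js ! (Suc i mod length js))" if "i < length js" for i
    using that by (auto intro!: nth_map mod_less_divisor)
  then show ?thesis
    unfolding m_product_def by (intro prod.cong) auto
qed

text \<open>Strong induction on the length: without repetition a closed walk has at most
  \<open>card J\<close> vertices; otherwise it is cut at a repeated vertex \<open>b\<close> into an
  inner loop at \<open>b\<close> and a shortened outer walk.\<close>

lemma closed_walk_products_eq:
  fixes g h :: "'i \<Rightarrow> 'i \<Rightarrow> 'k::comm_monoid_mult"
  assumes fin: "finite J"
    and eq: "\<And>js. js \<noteq> [] \<Longrightarrow> length js \<le> card J \<Longrightarrow> set js \<subseteq> J \<Longrightarrow> m_product g js = m_product h js"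
  shows "set (x # xs) \<subseteq> J \<Longrightarrow> walk_product g (x # xs @ [x]) = walk_product h (x # xs @ [x])"
proof (induction "length xs" arbitrary: x xs rule: less_induct)
  case less
  show ?case
  proof (cases "distinct (x # xs)")
    case True
    then have "length (x # xs) \<le> card J"
      using fin less.prems by (metis card_mono distinct_card)
    then show ?thesis
      using eq[of "x # xs"] less.prems by (simp add: m_product_Cons)
  next
    case False
    then obtain as b bs cs where split: "x # xs = as @ [b] @ bs @ [b] @ cs"
      using not_distinct_decomp by blast
    have inner: "walk_product g (b # bs @ [b]) = walk_product h (b # bs @ [b])"
    proof (rule less.hyps)
      have "length (x # xs) = length as + length bs + length cs + 2"
        unfolding split by simp
      then show "length bs < length xs" by simp
      show "set (b # bs) \<subseteq> J"
        using less.prems unfolding split by auto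
    qed
    have factor: "walk_product f (x # xs @ [x]) =
        walk_product f (b # bs @ [b]) * walk_product f (as @ b # cs @ [x])" for f :: "'i \<Rightarrow> 'i \<Rightarrow> 'k"
    proof -
      have eq: "x # xs @ [x] = as @ b # bs @ b # cs @ [x]"
        using split by (metis append_Cons append_assoc append_Nil)
      show ?thesis
        unfolding eq
        using walk_product_append[of f as b "bs @ b # cs @ [x]"]
          walk_product_append[of f "b # bs" b "cs @ [x]"] walk_product_append[of f as b "cs @ [x]"]
        by (simp add: ac_simps)
    qed
    \<comment> \<open>The outer walk is still based at \<open>x\<close>: for empty \<open>as\<close>
      the vertex \<open>b\<close> is \<open>x\<close> itself.\<close>
    have outer: "walk_product g (as @ b # cs @ [x]) = walk_product h (as @ b # cs @ [x])"
    proof -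
      have "\<exists>ys. as @ b # cs = x # ys \<and> length ys < length xs \<and> set ys \<subseteq> J"
        using split less.prems by (cases as) auto
      then obtain ys where ys: "as @ b # cs = x # ys" "length ys < length xs" "set ys \<subseteq> J"
        by blast
      then have "as @ b # cs @ [x] = x # ys @ [x]"
        by (metis append.assoc append_Cons)
      then show ?thesis
        using less.hyps[OF ys(2), of x] ys(3) less.prems by (metis insert_subset list.simps(15))
    qed
    show ?thesis
      unfolding factor inner outer ..
  qed
qed

section \<open>Unimodular rescaling of Hermitian matrices\<close>

text \<open>Covers the identity on the reals and \<open>cnj\<close> on the complex numbers, so that
  one argument serves both fields.\<close>

locale conjugation =
  fixes conj :: "'k::real_normed_field \<Rightarrow> 'k"
  assumes conj_add: "conj (a + b) = conj a + conj b"
    and conj_mult: "conj (a * b) = conj a * conj b"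
    and conj_conj [simp]: "conj (conj a) = a"
    and mult_conj: "a * conj a = of_real ((norm a)\<^sup>2)"
begin

lemma conj_0 [simp]: "conj 0 = 0"
  using conj_add[of 0 0] by simp

lemma conj_1 [simp]: "conj 1 = 1"
  using mult_conj[of 1] by simp

lemma unimodular_mult_conj: "norm a = 1 \<Longrightarrow> a * conj a = 1"
  by (simp add: mult_conj)

lemma norm_conj [simp]: "norm (conj a) = norm a"
proof (cases "a = 0")
  case False
  have "norm a * norm (conj a) = norm a * norm a"
    by (metis mult_conj norm_mult norm_of_real abs_power2 power2_eq_square)
  with False show ?thesis by simp
qed simp

text \<open>Traversing an edge backwards conjugates its factor. This is what makes the return along
  a path to its root computable.\<close>

lemma walk_product_rev:
  assumes "\<And>i j. f i j = conj (f j i)"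
  shows "walk_product f (rev xs) = conj (walk_product f xs)"
proof (induction xs rule: induct_list012)
  case (3 x y zs)
  have "f y x = conj (f x y)"
    by (rule assms)
  with 3 show ?case
    using walk_product_append[of f "rev zs" y "[x]"] by (simp add: conj_mult mult.commute)
qed simp_all

text \<open>Every interior vertex \<open>y\<close> contributes \<open>c y * conj (c y) = 1\<close>,
  so only the phases of the two endpoints survive.\<close>

lemma walk_product_rescale:
  assumes "\<And>j. j \<in> J \<Longrightarrow> norm (c j) = 1"
    and "\<And>j k. j \<in> J \<Longrightarrow> k \<in> J \<Longrightarrow> h j k = c j * conj (c k) * g j k"
  shows "set (x # xs) \<subseteq> J \<Longrightarrow>
    walk_product h (x # xs) = c x * conj (c (last (x # xs))) * walk_product g (x # xs)"
proof (induction xs arbitrary: x)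
  case Nil
  then show ?case using assms(1) by (simp add: unimodular_mult_conj)
next
  case (Cons y ys)
  have "walk_product h (x # y # ys) =
      c x * (c y * conj (c y)) * g x y * (conj (c (last (y # ys))) * walk_product g (y # ys))"
    using Cons by (simp add: assms(2) del: last.simps)
  then show ?case
    using Cons.prems assms(1)[of y] by (simp add: unimodular_mult_conj)
qed

lemma unimodular_rescaling_exists:
  assumes g: "\<And>i j. g i j = conj (g j i)" and h: "\<And>i j. h i j = conj (h j i)"
    and closed: "\<And>x xs. set (x # xs) \<subseteq> J \<Longrightarrow>
      walk_product g (x # xs @ [x]) = walk_product h (x # xs @ [x])"
  obtains c where "\<And>j. j \<in> J \<Longrightarrow> norm (c j) = 1"
    and "\<And>j k. j \<in> J \<Longrightarrow> k \<in> J \<Longrightarrow> h j k = c j * conj (c k) * g j k"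
proof -
  \<comment> \<open>The closed walk j, k, j has product \<open>g j k * conj (g j k)\<close>, the
    squared modulus; hence both matrices also have the same zero entries.\<close>
  have norm_eq: "norm (h j k) = norm (g j k)" if "j \<in> J" "k \<in> J" for j k
  proof -
    have "g j k * conj (g j k) = h j k * conj (h j k)"
      using closed[of j "[k]"] that g[of k j] h[of k j] by simp
    then have "(norm (g j k))\<^sup>2 = (norm (h j k))\<^sup>2"
      unfolding mult_conj using of_real_eq_iff by blast
    then show ?thesis by simp
  qed
  have norm_walk: "norm (walk_product h xs) = norm (walk_product g xs)" if "set xs \<subseteq> J" for xs
    using that by (induction xs rule: induct_list012) (auto simp: norm_mult norm_eq)
  define walk where "walk i j xs \<longleftrightarrow>
    set (i # xs) \<subseteq> J \<and> last (i # xs) = j \<and> walk_product g (i # xs) \<noteq> 0" for i j xs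
  have walk_edge: "walk i k (xs @ [k])" if "walk i j xs" "k \<in> J" "g j k \<noteq> 0" for i j k xs
    using that walk_product_append2[of "i # xs" g k "[]"] unfolding walk_def by auto
  \<comment> \<open>The choice depends on \<open>j\<close> only through the set of vertices joined
    to \<open>j\<close>, so it is constant on each component.\<close>
  define root where "root j = (SOME i. \<exists>xs. walk i j xs)" for j
  define path where "path j = (SOME xs. walk (root j) j xs)" for j
  have path: "walk (root j) j (path j)" if "j \<in> J" for j
  proof -
    have "walk j j []"
      using that by (simp add: walk_def)
    then have "\<exists>i xs. walk i j xs" by blast
    then have "\<exists>xs. walk (root j) j xs"
      unfolding root_def by (rule someI_ex)
    then show ?thesis
      unfolding path_def by (rule someI_ex)
  qed
  have root_eq: "root j = root k" if "j \<in> J" "k \<in> J" "g j k \<noteq> 0" for j k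
  proof -
    have "g k j \<noteq> 0"
      using g[of j k] that by auto
    then have "(\<exists>xs. walk i j xs) = (\<exists>xs. walk i k xs)" for i
      using walk_edge that by blast
    then show ?thesis
      unfolding root_def by simp
  qed
  define G where "G j = walk_product g (root j # path j)" for j
  define H where "H j = walk_product h (root j # path j)" for j
  \<comment> \<open>By telescoping, any solution with value 1 at the root must satisfy
    \<open>H j = conj (c j) * G j\<close>.\<close>
  define c where "c j = conj (H j / G j)" for j
  have G: "G j \<noteq> 0" and H: "norm (H j) = norm (G j)" if "j \<in> J" for j
    using path[OF that] norm_walk unfolding walk_def G_def H_def by auto
  have c: "norm (c j) = 1" if "j \<in> J" for j
    using G H that unfolding c_def by (simp add: norm_divide)
  have "h j k = c j * conj (c k) * g j k" if jk: "j \<in> J" "k \<in> J" for j k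
  proof (cases "g j k = 0")
    case True
    then show ?thesis
      using norm_eq[OF jk] by simp
  next
    case False
    let ?r = "root j"
    have rk: "root k = ?r"
      using root_eq[OF jk False] by simp
    \<comment> \<open>The closed walk runs from the root to \<open>j\<close>, crosses the edge to
      \<open>k\<close>, and returns along the reversed path of \<open>k\<close>.\<close>
    have split: "walk_product f (?r # (path j @ rev (path k)) @ [?r]) =
        walk_product f (?r # path j) * f j k * conj (walk_product f (root k # path k))"
      if f: "\<And>i j. f i j = conj (f j i)" for f
    proof -
      obtain ys where "rev (root k # path k) = k # ys"
        using path[OF jk(2)] unfolding walk_def
        by (metis hd_rev list.discI list.exhaust_sel rev_is_Nil_conv)
      then have eq: "rev (path k) @ [?r] = k # ys"
        using rk by simp
      have "last (?r # path j) = j"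
        using path[OF jk(1)] unfolding walk_def by simp
      then have "walk_product f ((?r # path j) @ k # ys) =
          walk_product f (?r # path j) * f j k * walk_product f (k # ys)"
        using walk_product_append2[of "?r # path j" f k ys] by simp
      then show ?thesis
        using walk_product_rev[of f "root k # path k", OF f] eq rk by simp
    qed
    have "set (?r # (path j @ rev (path k))) \<subseteq> J"
      using path[OF jk(1)] path[OF jk(2)] unfolding walk_def by auto
    from closed[OF this] have eq: "G j * g j k * conj (G k) = H j * h j k * conj (H k)"
      unfolding split[OF g] split[OF h] G_def H_def .
    have cG: "H i = conj (c i) * G i" if "i \<in> J" for i
      using G[OF that] by (simp add: c_def)
    have "G j * conj (G k) * g j k = G j * conj (G k) * (conj (c j) * c k * h j k)"
      using eq unfolding cG[OF jk(1)] cG[OF jk(2)] by (simp add: conj_mult mult_ac)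
    moreover have "conj (G k) \<noteq> 0"
      using G[OF jk(2)] norm_conj by (metis norm_eq_zero)
    ultimately have "g j k = conj (c j) * c k * h j k"
      using G[OF jk(1)] by simp
    then have "c j * conj (c k) * g j k = (c j * conj (c j)) * (c k * conj (c k)) * h j k"
      by (simp add: mult_ac)
    then show ?thesis
      using c[OF jk(1)] c[OF jk(2)] by (simp add: unimodular_mult_conj)
  qed
  with c show thesis
    by (rule that)
qed

end

section \<open>Inner product spaces over a field with conjugation\<close>

text \<open>The field \<open>'k\<close> carries no order, so \<open>ip_self\<close> expresses that
  \<open>ip x x\<close> is real and nonnegative by equating it with its own norm.\<close>

locale inner_product_space = conjugation conj + vector_space scale
  for conj :: "'k::real_normed_field \<Rightarrow> 'k"
    and scale :: "'k \<Rightarrow> 'a::ab_group_add \<Rightarrow> 'a" +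
  fixes ip :: "'a \<Rightarrow> 'a \<Rightarrow> 'k"
  assumes ip_commute: "ip x y = conj (ip y x)"
    and ip_add_left: "ip (x + y) z = ip x z + ip y z"
    and ip_scale_left: "ip (scale a x) y = a * ip x y"
    and ip_self: "ip x x = of_real (norm (ip x x))"
    and ip_self_eq_0: "ip x x = 0 \<Longrightarrow> x = 0"
begin

lemma ip_add_right: "ip x (y + z) = ip x y + ip x z"
  by (metis ip_commute ip_add_left conj_add)

lemma ip_scale_right: "ip x (scale a y) = conj a * ip x y"
  by (metis ip_commute ip_scale_left conj_mult)

lemma ip_0_left [simp]: "ip 0 y = 0"
  using ip_add_left[of 0 0 y] by simp

lemma ip_0_right [simp]: "ip x 0 = 0"
  using ip_add_right[of x 0 0] by simp

lemma ip_sum_left: "ip (sum f A) y = (\<Sum>i\<in>A. ip (f i) y)"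
  by (induction A rule: infinite_finite_induct) (auto simp: ip_add_left)

lemma ip_sum_right: "ip x (sum f A) = (\<Sum>i\<in>A. ip x (f i))"
  by (induction A rule: infinite_finite_induct) (auto simp: ip_add_right)

lemma ip_self_eq: "ip x x = of_real ((induced_norm ip x)\<^sup>2)"
  using ip_self[of x] by (simp add: induced_norm_def)

lemma ip_sums:
  "ip (\<Sum>j\<in>J. scale (a j) (v j)) (\<Sum>k\<in>J. scale (b k) (v k)) =
    (\<Sum>j\<in>J. \<Sum>k\<in>J. a j * conj (b k) * ip (v j) (v k))"
  unfolding ip_sum_left[of _ J "sum _ J"] ip_scale_left
  by (simp add: ip_sum_right ip_scale_right sum_distrib_left mult.assoc)

text \<open>Coefficients are indexed by \<open>J\<close> rather than by the vectors, since
  \<open>v\<close> may repeat vectors.\<close>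

lemma span_image_eq:
  assumes "finite J"
  shows "span (v ` J) = range (\<lambda>a. \<Sum>j\<in>J. scale (a j) (v j))"
proof -
  define L where "L a = (\<Sum>j\<in>J. scale (a j) (v j))" for a
  have "span (v ` J) = range L"
  proof (rule span_unique)
    show "v ` J \<subseteq> range L"
    proof (rule image_subsetI)
      fix j assume "j \<in> J"
      have "L (\<lambda>k. if k = j then 1 else 0) = (\<Sum>k\<in>J. if k = j then v k else 0)"
        unfolding L_def by (intro sum.cong) auto
      also have "\<dots> = v j"
        using assms \<open>j \<in> J\<close> by simp
      finally show "v j \<in> range L"
        by (metis rangeI)
    qed
    show "subspace (range L)"
    proof (rule subspaceI)
      have "L (\<lambda>_. 0) = 0"
        by (simp add: L_def)
      then show "0 \<in> range L"
        by (metis rangeI)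
    next
      fix x y assume "x \<in> range L" "y \<in> range L"
      then obtain a b where "x = L a" "y = L b" by blast
      then have "x + y = L (\<lambda>j. a j + b j)"
        by (simp add: L_def scale_left_distrib sum.distrib)
      then show "x + y \<in> range L" by blast
    next
      fix r x assume "x \<in> range L"
      then obtain a where "x = L a" by blast
      then have "scale r x = L (\<lambda>j. r * a j)"
        by (simp add: L_def scale_sum_right)
      then show "scale r x \<in> range L" by blast
    qed
    show "range L \<subseteq> T" if "v ` J \<subseteq> T" "subspace T" for T
      using that by (auto simp: L_def intro!: subspace_sum subspace_scale)
  qed
  then show ?thesis
    by (simp add: L_def[abs_def])
qed

end

section \<open>Unitary maps and Gramians\<close>

locale inner_product_space_pair =
  conjugation conj +
  s1: inner_product_space conj scale1 ip1 +
  s2: inner_product_space conj scale2 ip2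
  for conj :: "'k::real_normed_field \<Rightarrow> 'k"
    and scale1 :: "'k \<Rightarrow> 'a::ab_group_add \<Rightarrow> 'a" and ip1 :: "'a \<Rightarrow> 'a \<Rightarrow> 'k"
    and scale2 :: "'k \<Rightarrow> 'b::ab_group_add \<Rightarrow> 'b" and ip2 :: "'b \<Rightarrow> 'b \<Rightarrow> 'k"
begin

text \<open>
  Polarization: expanding \<open>\<parallel>U (a x + y)\<parallel> = \<parallel>a x + y\<parallel>\<close> equates the
  self-adjoint parts of \<open>a \<langle>U x, U y\<rangle>\<close> and \<open>a \<langle>x, y\<rangle>\<close>; the choice
  \<open>a = conj (\<langle>U x, U y\<rangle> - \<langle>x, y\<rangle>)\<close> works over both fields.
\<close>

lemma unitary_map_preserves_ip:
  assumes U: "unitary_map scale1 ip1 H1 scale2 ip2 H2 U" and "s1.subspace H1"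
    and xy: "x \<in> H1" "y \<in> H1"
  shows "ip2 (U x) (U y) = ip1 x y"
proof -
  have self: "ip2 (U z) (U z) = ip1 z z" if "z \<in> H1" for z
    using U that unfolding unitary_map_def s1.ip_self_eq s2.ip_self_eq by auto
  have re: "a * ip2 (U x) (U y) + conj (a * ip2 (U x) (U y)) = a * ip1 x y + conj (a * ip1 x y)" for a
  proof -
    have ax: "scale1 a x \<in> H1"
      using assms s1.subspace_scale by blast
    then have "scale1 a x + y \<in> H1"
      using assms s1.subspace_add by blast
    from self[OF this] have "ip2 (scale2 a (U x) + U y) (scale2 a (U x) + U y) =
        ip1 (scale1 a x + y) (scale1 a x + y)"
      using U ax xy unfolding unitary_map_def by simp
    then show ?thesis
      using self[OF xy(1)] self[OF xy(2)] s1.ip_commute[of y x] s2.ip_commute[of "U y" "U x"]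
      by (simp add: s1.ip_add_left s1.ip_add_right s1.ip_scale_left s1.ip_scale_right
          s2.ip_add_left s2.ip_add_right s2.ip_scale_left s2.ip_scale_right conj_mult algebra_simps)
  qed
  define d where "d = ip2 (U x) (U y) - ip1 x y"
  have "conj d * d + conj (conj d * d) = 0"
  proof -
    have "ip2 (U x) (U y) = d + ip1 x y" by (simp add: d_def)
    then show ?thesis
      using re[of "conj d"] by (simp add: conj_mult conj_add algebra_simps)
  qed
  then have "2 * (d * conj d) = 0"
    by (simp add: conj_mult mult_ac)
  then have "d = 0"
    unfolding mult_conj by simp
  then show ?thesis
    by (simp add: d_def)
qed

text \<open>The map sends a combination of the \<open>v j\<close> to the combination of the
  \<open>u j\<close> with the same coefficients. It is well defined because a combination of the
  \<open>v j\<close> that vanishes has a counterpart of norm zero, by equality of the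
  Gramians.\<close>

lemma unitary_map_of_Gramian_eq:
  assumes fin: "finite J"
    and gram: "\<And>j k. j \<in> J \<Longrightarrow> k \<in> J \<Longrightarrow> ip2 (u j) (u k) = ip1 (v j) (v k)"
  obtains U where "unitary_map scale1 ip1 (s1.span (v ` J)) scale2 ip2 (s2.span (u ` J)) U"
    and "\<And>j. j \<in> J \<Longrightarrow> U (v j) = u j"
proof -
  define L1 where "L1 a = (\<Sum>j\<in>J. scale1 (a j) (v j))" for a
  define L2 where "L2 a = (\<Sum>j\<in>J. scale2 (a j) (u j))" for a
  have ip: "ip2 (L2 a) (L2 b) = ip1 (L1 a) (L1 b)" for a b
    unfolding L1_def L2_def s1.ip_sums s2.ip_sums by (intro sum.cong) (auto simp: gram)
  have eq: "L2 a = L2 b" if "L1 a = L1 b" for a b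
  proof -
    have "L1 (\<lambda>j. a j - b j) = 0" "L2 (\<lambda>j. a j - b j) = L2 a - L2 b"
      using that unfolding L1_def L2_def
      by (simp_all add: s1.scale_left_diff_distrib s2.scale_left_diff_distrib sum_subtractf)
    then have "ip2 (L2 a - L2 b) (L2 a - L2 b) = 0"
      using ip[of "\<lambda>j. a j - b j" "\<lambda>j. a j - b j"] by simp
    then show ?thesis
      using s2.ip_self_eq_0 by fastforce
  qed
  \<comment> \<open>Any coefficients representing \<open>x\<close> will do, by \<open>eq\<close>;
    outside the span the value is arbitrary.\<close>
  define U where "U x = L2 (SOME a. L1 a = x)" for x
  have U: "U (L1 a) = L2 a" for a
    unfolding U_def by (rule eq) (metis (mono_tags, lifting) someI)
  have span1: "s1.span (v ` J) = range L1" and span2: "s2.span (u ` J) = range L2"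
    unfolding L1_def L2_def s1.span_image_eq[OF fin] s2.span_image_eq[OF fin] by rule+
  have "unitary_map scale1 ip1 (range L1) scale2 ip2 (range L2) U"
    unfolding unitary_map_def
  proof (intro conjI ballI allI)
    fix x y assume "x \<in> range L1" "y \<in> range L1"
    then obtain a b where ab: "x = L1 a" "y = L1 b" by blast
    have "L1 a + L1 b = L1 (\<lambda>j. a j + b j)" "L2 a + L2 b = L2 (\<lambda>j. a j + b j)"
      unfolding L1_def L2_def by (simp_all add: s1.scale_left_distrib s2.scale_left_distrib sum.distrib)
    then show "U (x + y) = U x + U y"
      by (simp add: ab U)
  next
    fix r x assume "x \<in> range L1"
    then obtain a where a: "x = L1 a" by blast
    have "scale1 r (L1 a) = L1 (\<lambda>j. r * a j)" "scale2 r (L2 a) = L2 (\<lambda>j. r * a j)"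
      unfolding L1_def L2_def by (simp_all add: s1.scale_sum_right s2.scale_sum_right)
    then show "U (scale1 r x) = scale2 r (U x)"
      by (simp add: a U)
  next
    fix x assume "x \<in> range L1"
    then show "induced_norm ip2 (U x) = induced_norm ip1 x"
      by (auto simp: U induced_norm_def ip)
  next
    show "U ` range L1 = range L2"
      by (auto simp: U image_image)
  qed
  moreover have "U (v j) = u j" if "j \<in> J" for j
  proof -
    define e where "e k = (if k = j then 1 else 0 :: 'k)" for k
    have "L1 e = (\<Sum>k\<in>J. if k = j then v k else 0)" "L2 e = (\<Sum>k\<in>J. if k = j then u k else 0)"
      unfolding L1_def L2_def e_def by (intro sum.cong; simp)+
    then have "L1 e = v j" "L2 e = u j"
      using fin that by simp_all
    then show ?thesis
      using U[of e] by simp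
  qed
  ultimately show thesis
    using that span1 span2 by simp
qed

text \<open>Removing the phases from \<open>w\<close> reduces the backward direction to sequences
  with equal Gramians.\<close>

lemma projectively_unitarily_equivalent_iff_Gramian:
  assumes fin: "finite J"
  shows "projectively_unitarily_equivalent scale1 ip1 scale2 ip2 J v w \<longleftrightarrow>
    (\<exists>c. (\<forall>j\<in>J. norm (c j) = 1) \<and>
      (\<forall>j\<in>J. \<forall>k\<in>J. ip2 (w j) (w k) = c j * conj (c k) * ip1 (v j) (v k)))"
    (is "?lhs \<longleftrightarrow> ?rhs")
proof
  assume ?lhs
  then obtain U c
    where U: "unitary_map scale1 ip1 (s1.span (v ` J)) scale2 ip2 (s2.span (w ` J)) U"
      and c: "\<forall>j\<in>J. norm (c j) = 1 \<and> w j = scale2 (c j) (U (v j))"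
    unfolding projectively_unitarily_equivalent_def by blast
  have "ip2 (U (v j)) (U (v k)) = ip1 (v j) (v k)" if "j \<in> J" "k \<in> J" for j k
    using that by (intro unitary_map_preserves_ip[OF U]) (auto intro: s1.span_base)
  then have "ip2 (w j) (w k) = c j * conj (c k) * ip1 (v j) (v k)" if "j \<in> J" "k \<in> J" for j k
    using c that by (simp add: s2.ip_scale_left s2.ip_scale_right)
  with c show ?rhs by blast
next
  assume ?rhs
  then obtain c where c: "\<And>j. j \<in> J \<Longrightarrow> norm (c j) = 1"
    and gram: "\<And>j k. j \<in> J \<Longrightarrow> k \<in> J \<Longrightarrow> ip2 (w j) (w k) = c j * conj (c k) * ip1 (v j) (v k)"
    by blast
  define u where "u j = scale2 (conj (c j)) (w j)" for j
  have w: "w j = scale2 (c j) (u j)" if "j \<in> J" for j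
    using c[OF that] by (simp add: u_def unimodular_mult_conj)
  have "ip2 (u j) (u k) = (c j * conj (c j)) * (c k * conj (c k)) * ip1 (v j) (v k)"
    if "j \<in> J" "k \<in> J" for j k
    using that by (simp add: u_def s2.ip_scale_left s2.ip_scale_right gram mult_ac)
  then have "ip2 (u j) (u k) = ip1 (v j) (v k)" if "j \<in> J" "k \<in> J" for j k
    using c that by (simp add: unimodular_mult_conj)
  then obtain U
    where U: "unitary_map scale1 ip1 (s1.span (v ` J)) scale2 ip2 (s2.span (u ` J)) U"
      and Uv: "\<And>j. j \<in> J \<Longrightarrow> U (v j) = u j"
    using unitary_map_of_Gramian_eq[of J u v, OF fin] by blast
  \<comment> \<open>Unimodular factors are invertible, so each family lies in the span of the
    other.\<close>
  have "s2.span (u ` J) = s2.span (w ` J)"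
    unfolding s2.span_eq
  proof safe
    fix j assume j: "j \<in> J"
    show "u j \<in> s2.span (w ` J)"
      unfolding u_def using j by (intro s2.span_scale s2.span_base imageI)
    show "w j \<in> s2.span (u ` J)"
      unfolding w[OF j] using j by (intro s2.span_scale s2.span_base imageI)
  qed
  with U Uv w c show ?lhs
    unfolding projectively_unitarily_equivalent_def by (metis (no_types, lifting))
qed

theorem projectively_unitarily_equivalent_iff_m_products:
  assumes fin: "finite J"
  shows "projectively_unitarily_equivalent scale1 ip1 scale2 ip2 J v w \<longleftrightarrow>
    (\<forall>m js. 1 \<le> m \<and> m \<le> card J \<and> length js = m \<and> set js \<subseteq> J \<longrightarrow>
      m_product ip1 (map v js) = m_product ip2 (map w js))"
proof -
  define g where "g i j = ip1 (v i) (v j)" for i j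
  define h where "h i j = ip2 (w i) (w j)" for i j
  have herm: "g i j = conj (g j i)" "h i j = conj (h j i)" for i j
    unfolding g_def h_def by (rule s1.ip_commute s2.ip_commute)+
  have "(\<exists>c. (\<forall>j\<in>J. norm (c j) = 1) \<and> (\<forall>j\<in>J. \<forall>k\<in>J. h j k = c j * conj (c k) * g j k)) \<longleftrightarrow>
    (\<forall>m js. 1 \<le> m \<and> m \<le> card J \<and> length js = m \<and> set js \<subseteq> J \<longrightarrow> m_product g js = m_product h js)"
    (is "?L \<longleftrightarrow> ?R")
  proof
    assume ?L
    then obtain c where c: "\<And>j. j \<in> J \<Longrightarrow> norm (c j) = 1"
      and h: "\<And>j k. j \<in> J \<Longrightarrow> k \<in> J \<Longrightarrow> h j k = c j * conj (c k) * g j k"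
      by blast
    \<comment> \<open>The two ends of a closed walk coincide, so the remaining phases cancel as
      well, for walks of any length.\<close>
    have "m_product g (x # xs) = m_product h (x # xs)" if "set (x # xs) \<subseteq> J" for x xs
    proof -
      have "walk_product h (x # xs @ [x]) =
          c x * conj (c (last (x # xs @ [x]))) * walk_product g (x # xs @ [x])"
        using c h that by (intro walk_product_rescale[where J = J]) auto
      then show ?thesis
        using that c[of x] by (simp add: m_product_Cons unimodular_mult_conj)
    qed
    then show ?R
      by (metis length_0_conv list.exhaust not_one_le_zero)
  next
    assume R: ?R
    have "walk_product g (x # xs @ [x]) = walk_product h (x # xs @ [x])" if "set (x # xs) \<subseteq> J" for x xs
    proof (rule closed_walk_products_eq[OF fin _ that])
      show "m_product g js = m_product h js" if "js \<noteq> []" "length js \<le> card J" "set js \<subseteq> J" for js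
        using R that by (simp add: Suc_le_eq)
    qed
    then show ?L
    proof (rule unimodular_rescaling_exists[OF herm])
      fix c assume "\<And>j. j \<in> J \<Longrightarrow> norm (c j) = 1"
        and "\<And>j k. j \<in> J \<Longrightarrow> k \<in> J \<Longrightarrow> h j k = c j * conj (c k) * g j k"
      then show ?L by (intro exI[of _ c]) auto
    qed
  qed
  then show ?thesis
    unfolding projectively_unitarily_equivalent_iff_Gramian[OF fin] m_product_map g_def h_def .
qed

end

section \<open>The real and complex instances\<close>

lemma inner_product_space_pair_real:
  "inner_product_space_pair (\<lambda>x. x)
    (scaleR :: real \<Rightarrow> 'a::real_inner \<Rightarrow> 'a) inner (scaleR :: real \<Rightarrow> 'b::real_inner \<Rightarrow> 'b) inner"
proof -
  \<comment> \<open>The fresh type \<open>'c\<close> is generalised afterwards, so the fact applies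
    to both spaces.\<close>
  have *: "inner_product_space (\<lambda>x. x) (scaleR :: real \<Rightarrow> 'c::real_inner \<Rightarrow> 'c) inner"
  proof (intro inner_product_space.intro)
    show "conjugation (\<lambda>x::real. x)"
      by unfold_locales (simp_all add: power2_eq_square)
    show "vector_space (scaleR :: real \<Rightarrow> 'c \<Rightarrow> 'c)"
      by unfold_locales (simp_all add: scaleR_add_right scaleR_add_left)
    show "inner_product_space_axioms (\<lambda>x. x) scaleR (inner :: 'c \<Rightarrow> 'c \<Rightarrow> real)"
      by unfold_locales (simp_all add: inner_add_left, rule inner_commute)
  qed
  show ?thesis
    by (intro inner_product_space_pair.intro * inner_product_space.axioms(1)[OF *])
qed

text \<open>The class bounds only the real part; the imaginary part vanishes by Hermitian
  symmetry.\<close>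

lemma cinner_self_real: "cinner x x = of_real (norm (cinner x x))"
proof -
  have "Im (cinner x x) = 0"
    using arg_cong[OF cinner_commute[of x x], of Im] by simp
  then have "cinner x x = of_real (Re (cinner x x))"
    by (intro complex_eqI) simp_all
  then show ?thesis
    using cinner_ge_zero[of x] by (metis norm_of_real abs_of_nonneg)
qed

lemma inner_product_space_pair_complex:
  "inner_product_space_pair cnj
    (scaleC :: complex \<Rightarrow> 'a::complex_inner \<Rightarrow> 'a) cinner
    (scaleC :: complex \<Rightarrow> 'b::complex_inner \<Rightarrow> 'b) cinner"
proof -
  have *: "inner_product_space cnj (scaleC :: complex \<Rightarrow> 'c::complex_inner \<Rightarrow> 'c) cinner"
  proof (intro inner_product_space.intro vector_space_scaleC)
    show "conjugation cnj"
      by unfold_locales (auto simp: complex_norm_square[symmetric] simp del: of_real_power)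
    show "inner_product_space_axioms cnj scaleC (cinner :: 'c \<Rightarrow> 'c \<Rightarrow> complex)"
      by unfold_locales
        (rule cinner_commute cinner_add_left cinner_scaleC_left cinner_self_real |
          simp add: cinner_eq_zero_iff)+
  qed
  show ?thesis
    by (intro inner_product_space_pair.intro * inner_product_space.axioms(1)[OF *])
qed

theorem theorem3p2:
  fixes n :: nat
    and v :: "nat \<Rightarrow> 'a::real_inner" and w :: "nat \<Rightarrow> 'b::real_inner"
    and v' :: "nat \<Rightarrow> 'c::complex_inner" and w' :: "nat \<Rightarrow> 'd::complex_inner"
  shows
    "(projectively_unitarily_equivalent scaleR inner scaleR inner {1..n} v w \<longleftrightarrow>
       (\<forall>m js. 1 \<le> m \<and> m \<le> n \<and> length js = m \<and> set js \<subseteq> {1..n} \<longrightarrow>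
          m_product inner (map v js) = m_product inner (map w js)))
     \<and>
     (projectively_unitarily_equivalent scaleC cinner scaleC cinner {1..n} v' w' \<longleftrightarrow>
       (\<forall>m js. 1 \<le> m \<and> m \<le> n \<and> length js = m \<and> set js \<subseteq> {1..n} \<longrightarrow>
          m_product cinner (map v' js) = m_product cinner (map w' js)))"
  using inner_product_space_pair.projectively_unitarily_equivalent_iff_m_products
      [OF inner_product_space_pair_real, of "{1..n}" v w]
    inner_product_space_pair.projectively_unitarily_equivalent_iff_m_products
      [OF inner_product_space_pair_complex, of "{1..n}" v' w']
  by simp

end
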